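(* Let $m>0$, $\mu_1^\dagger\in(0,m)$ and positive reals $t_1,t_2,r_1,r_2,\gamma_1,\gamma_2,b,\beta$ satisfy $$\Big(\frac{\gamma_1}{\gamma_2}>\frac{t_1}{t_2}\ \text{ and }\ \frac{\gamma_1}{\gamma_2}<\frac{e^{\beta t_1}-1}{e^{\beta t_1}}\Big)\quad\text{or}\quad\Big(\frac{\gamma_1}{\gamma_2}<\frac{t_1}{t_2}\ \text{ and }\ \frac{\gamma_1}{\gamma_2}>\frac{e^{\beta t_2}}{e^{\beta t_2}-1}\Big),$$ and $$\frac{r_1}{e^{\beta\tau_1(\mu_1^\dagger)}-1}=\frac{r_2}{e^{\beta\tau_2(\mu_1^\dagger)}-1},\qquad b<\gamma_1\frac{\mu_1^\dagger}{t_1}+\gamma_2\frac{m-\mu_1^\dagger}{t_2},$$ where $\tau_1,\tau_2$ are the sojourn times of the two-action one-resource model with parameters $m,t_1,t_2,\gamma_1,\gamma_2,b$. Then $\mu_1^\dagger$ is an unstable equilibrium of the game $\mathcal F^\beta$ with payoffs $F_i^\beta(\mu_1)=\dfrac{r_i}{e^{\beta\tau_i(\mu_1)}-1}$, $i=1,2$, under the projection dynamics $$\dot\mu_1=\begin{cases}F_1^\beta(\mu_1)-F_2^\beta(\mu_1)&\text{if }\mu_1\in(0,m),\\\max\{F_1^\beta(\mu_1)-F_2^\beta(\mu_1),0\}&\text{if }\mu_1=0,\\\min\{F_1^\beta(\mu_1)-F_2^\beta(\mu_1),0\}&\text{if }\mu_1=m.\end{cases}$$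
   Context: Two-action one-resource model: a total mass $m>0$ of agents, of which $\mu_1\in[0,m]$ use action 1 and $\mu_2=m-\mu_1$ use action 2. Action $i$ has constant execution time $t_i$, reward $r_i$, and requires $\gamma_i$ units of a common resource supplied at rate $b$. The sojourn times are $\tau_i(\mu_1)=t_i+\gamma_iw(\mu_1)$, where $w(\mu_1)\ge0$ is the optimal Lagrange multiplier of the constraint in the problem $$\max_{(x_1,x_2)\in\mathbb R_{\ge0}^2}\ \mu_1\log x_1+\mu_2\log x_2-t_1x_1-t_2x_2\quad\text{s.t.}\quad\gamma_1x_1+\gamma_2x_2\le b$$ (convention $0\log0=0$). Equivalently, $w(\mu_1)=0$ if $\gamma_1\mu_1/t_1+\gamma_2(m-\mu_1)/t_2\le b$, and otherwise $w(\mu_1)$ is the unique positive solution of $\gamma_1\frac{\mu_1}{t_1+\gamma_1w}+\gamma_2\frac{m-\mu_1}{t_2+\gamma_2w}=b$. Equilibrium of $\mathcal F^\beta$: $\mu_1\in[0,m]$ with $F_1^\beta(\mu_1)\ge F_2^\beta(\mu_1)$ if $\mu_1>0$ and $F_2^\beta(\mu_1)\ge F_1^\beta(\mu_1)$ if $\mu_1<m$ (so an interior $\mu_1$ is an equilibrium iff $F_1^\beta(\mu_1)=F_2^\beta(\mu_1)$). Unstable means not Lyapunov stable. *)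

theory Defs
  imports "HOL-Analysis.Analysis"
begin

section \<open>The two-action one-resource model\<close>

text \<open>
  The term \<open>a log x\<close> for \<open>a \<ge> 0\<close>, \<open>x \<ge> 0\<close>, with \<open>0 log 0 = 0\<close> and \<open>a log 0 = -\<infinity>\<close> for \<open>a > 0\<close>.
  It has to be extended-real valued because the real \<open>ln\<close> is totalised at \<open>0\<close>.
\<close>
definition weighted_log :: "real \<Rightarrow> real \<Rightarrow> ereal" where
  "weighted_log a x = (if a = 0 then 0 else if x = 0 then -\<infinity> else ereal (a * ln x))"

definition objective ::
  "real \<Rightarrow> real \<Rightarrow> real \<Rightarrow> real \<Rightarrow> real \<times> real \<Rightarrow> ereal" where
  "objective m t1 t2 \<mu>1 = (\<lambda>(x1, x2).
     weighted_log \<mu>1 x1 + weighted_log (m - \<mu>1) x2 + ereal (- t1 * x1 - t2 * x2))"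

text \<open>The resource constraint reads \<open>0 \<le> resource_slack \<gamma>1 \<gamma>2 b x\<close>.\<close>
definition resource_slack :: "real \<Rightarrow> real \<Rightarrow> real \<Rightarrow> real \<times> real \<Rightarrow> real" where
  "resource_slack \<gamma>1 \<gamma>2 b = (\<lambda>(x1, x2). b - (\<gamma>1 * x1 + \<gamma>2 * x2))"

definition lagrangian ::
  "real \<Rightarrow> real \<Rightarrow> real \<Rightarrow> real \<Rightarrow> real \<Rightarrow> real \<Rightarrow> real \<Rightarrow> real \<times> real \<Rightarrow> real \<Rightarrow> ereal" where
  "lagrangian m t1 t2 \<gamma>1 \<gamma>2 b \<mu>1 x v =
     objective m t1 t2 \<mu>1 x + ereal (v * resource_slack \<gamma>1 \<gamma>2 b x)"

definition dual_function ::
  "real \<Rightarrow> real \<Rightarrow> real \<Rightarrow> real \<Rightarrow> real \<Rightarrow> real \<Rightarrow> real \<Rightarrow> real \<Rightarrow> ereal" where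
  "dual_function m t1 t2 \<gamma>1 \<gamma>2 b \<mu>1 v =
     (SUP x\<in>{0..} \<times> {0..}. lagrangian m t1 t2 \<gamma>1 \<gamma>2 b \<mu>1 x v)"

text \<open>
  An optimal Lagrange multiplier is an optimal solution of the dual problem (the primal is a
  maximisation, so the dual is a minimisation). There is no duality gap: the problem is concave
  and \<open>b > 0\<close> gives a strictly feasible point.
\<close>
definition optimal_multiplier ::
  "real \<Rightarrow> real \<Rightarrow> real \<Rightarrow> real \<Rightarrow> real \<Rightarrow> real \<Rightarrow> real \<Rightarrow> real \<Rightarrow> bool" where
  "optimal_multiplier m t1 t2 \<gamma>1 \<gamma>2 b \<mu>1 w \<longleftrightarrow>
     0 \<le> w \<and>
     (\<forall>v\<ge>0. dual_function m t1 t2 \<gamma>1 \<gamma>2 b \<mu>1 w \<le> dual_function m t1 t2 \<gamma>1 \<gamma>2 b \<mu>1 v)"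

text \<open>
  For positive parameters and \<open>0 \<le> \<mu>1 \<le> m\<close> the dual function is finite and strictly convex on
  \<open>[0, \<infinity>)\<close> and tends to \<open>\<infinity>\<close>, so the optimal multiplier exists and is unique.
\<close>
definition multiplier ::
  "real \<Rightarrow> real \<Rightarrow> real \<Rightarrow> real \<Rightarrow> real \<Rightarrow> real \<Rightarrow> real \<Rightarrow> real" where
  "multiplier m t1 t2 \<gamma>1 \<gamma>2 b \<mu>1 = (THE w. optimal_multiplier m t1 t2 \<gamma>1 \<gamma>2 b \<mu>1 w)"

definition sojourn1 ::
  "real \<Rightarrow> real \<Rightarrow> real \<Rightarrow> real \<Rightarrow> real \<Rightarrow> real \<Rightarrow> real \<Rightarrow> real" where
  "sojourn1 m t1 t2 \<gamma>1 \<gamma>2 b \<mu>1 = t1 + \<gamma>1 * multiplier m t1 t2 \<gamma>1 \<gamma>2 b \<mu>1"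

definition sojourn2 ::
  "real \<Rightarrow> real \<Rightarrow> real \<Rightarrow> real \<Rightarrow> real \<Rightarrow> real \<Rightarrow> real \<Rightarrow> real" where
  "sojourn2 m t1 t2 \<gamma>1 \<gamma>2 b \<mu>1 = t2 + \<gamma>2 * multiplier m t1 t2 \<gamma>1 \<gamma>2 b \<mu>1"

text \<open>The payoff \<open>r / (e^(\<beta> \<tau>) - 1)\<close> of an action with reward \<open>r\<close> and sojourn time function \<open>\<tau>\<close>.\<close>
definition discounted_payoff :: "real \<Rightarrow> real \<Rightarrow> (real \<Rightarrow> real) \<Rightarrow> real \<Rightarrow> real" where
  "discounted_payoff \<beta> r \<tau> \<mu>1 = r / (exp (\<beta> * \<tau> \<mu>1) - 1)"


section \<open>Two-action population games under the projection dynamics\<close>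

text \<open>
  The state is the mass \<open>\<mu>1 \<in> {0..m}\<close> using action 1; \<open>F1\<close> and \<open>F2\<close> are the payoffs of the two
  actions as functions of \<open>\<mu>1\<close>.
\<close>
definition equilibrium :: "real \<Rightarrow> (real \<Rightarrow> real) \<Rightarrow> (real \<Rightarrow> real) \<Rightarrow> real \<Rightarrow> bool" where
  "equilibrium m F1 F2 \<mu>1 \<longleftrightarrow>
     \<mu>1 \<in> {0..m} \<and> (\<mu>1 > 0 \<longrightarrow> F1 \<mu>1 \<ge> F2 \<mu>1) \<and> (\<mu>1 < m \<longrightarrow> F2 \<mu>1 \<ge> F1 \<mu>1)"

text \<open>Only the values on \<open>{0..m}\<close> matter; the last branch is meant for \<open>\<mu>1 = m\<close>.\<close>
definition projection_field ::
  "real \<Rightarrow> (real \<Rightarrow> real) \<Rightarrow> (real \<Rightarrow> real) \<Rightarrow> real \<Rightarrow> real" where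
  "projection_field m F1 F2 \<mu>1 =
     (if 0 < \<mu>1 \<and> \<mu>1 < m then F1 \<mu>1 - F2 \<mu>1
      else if \<mu>1 = 0 then max (F1 \<mu>1 - F2 \<mu>1) 0
      else min (F1 \<mu>1 - F2 \<mu>1) 0)"

text \<open>
  Solutions are taken in the sense of Caratheodory (absolutely continuous, satisfying the equation
  almost everywhere), written in the equivalent integral form: the field is discontinuous at the
  end points of \<open>{0..m}\<close>, so a trajectory hitting the boundary has in general no derivative there.
\<close>
definition caratheodory_solution ::
  "real set \<Rightarrow> (real \<Rightarrow> real) \<Rightarrow> (real \<Rightarrow> real) \<Rightarrow> bool" where
  "caratheodory_solution X V x \<longleftrightarrow>
     (\<forall>s\<ge>0. x s \<in> X) \<and>
     (\<forall>s\<ge>0. (\<lambda>u. V (x u)) absolutely_integrable_on {0..s} \<and>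
             x s = x 0 + integral {0..s} (\<lambda>u. V (x u)))"

definition lyapunov_stable :: "real set \<Rightarrow> (real \<Rightarrow> real) \<Rightarrow> real \<Rightarrow> bool" where
  "lyapunov_stable X V p \<longleftrightarrow>
     (\<forall>\<epsilon>>0. \<exists>\<delta>>0. \<forall>x. caratheodory_solution X V x \<and> dist (x 0) p < \<delta> \<longrightarrow>
        (\<forall>s\<ge>0. dist (x s) p < \<epsilon>))"

definition unstable_equilibrium :: "real \<Rightarrow> (real \<Rightarrow> real) \<Rightarrow> (real \<Rightarrow> real) \<Rightarrow> real \<Rightarrow> bool" where
  "unstable_equilibrium m F1 F2 p \<longleftrightarrow>
     equilibrium m F1 F2 p \<and> \<not> lyapunov_stable {0..m} (projection_field m F1 F2) p"

end

theory Submission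
  imports Defs
begin

text \<open>
  Under the first alternative of the hypothesis (the second one is its mirror image under exchanging
  the two actions) the multiplier \<open>w\<close> strictly increases with the mass using action 1 on \<open>[\<mu>, m]\<close>,
  because \<open>\<gamma>1 / (t1 + \<gamma>1 w) > \<gamma>2 / (t2 + \<gamma>2 w)\<close>. The bound on \<open>\<gamma>1 / \<gamma>2\<close> makes the logarithm of the
  payoff ratio \<open>F1 / F2\<close> strictly increasing in \<open>w\<close>. Hence \<open>F1 > F2\<close> on all of \<open>(\<mu>, m]\<close>, and a
  trajectory started there, however close to \<open>\<mu>\<close>, reaches the end point \<open>m\<close> in finite time.
\<close>

section \<open>The Lagrange multiplier\<close>

text \<open>For positive \<open>a\<close> and \<open>x\<close> this is \<open>ln z < z - 1\<close>
  at \<open>z = c * x / a\<close>, where \<open>z = 1\<close> marks the maximizer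
  \<open>a / c\<close>. With \<open>a = 0\<close> only the linear cost is left, and with
  \<open>x = 0 < a\<close> the left side is \<open>-\<infinity>\<close>.\<close>

lemma weighted_log_linear_less:
  fixes a c x :: real
  assumes "a \<ge> 0" "c > 0" "x \<ge> 0" "x \<noteq> a / c"
  shows "weighted_log a x + ereal (- c * x) < weighted_log a (a / c) + ereal (- c * (a / c))"
proof (cases "a = 0 \<or> x = 0")
  case True
  then show ?thesis using assms by (auto simp: weighted_log_def)
next
  case False
  then have a: "a > 0" and x: "x > 0" using assms by auto
  have "c * x / a > 0" "c * x / a \<noteq> 1"
    using a x assms by (auto simp: field_simps)
  then have "ln (c * x / a) < c * x / a - 1"
    by (meson le_neq_trans ln_le_minus_one ln_eq_minus_one)
  moreover have "ln (c * x / a) = ln x - ln (a / c)"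
    using a x assms by (simp add: ln_div ln_mult)
  ultimately have "a * (ln x - ln (a / c)) < a * (c * x / a - 1)"
    using a by simp
  then have "a * ln x - c * x < a * ln (a / c) - a"
    using a by (simp add: algebra_simps)
  then show ?thesis using a x assms by (simp add: weighted_log_def)
qed

lemma weighted_log_maximizer_finite:
  assumes "a \<ge> 0" "c > 0"
  shows "\<bar>weighted_log a (a / c)\<bar> \<noteq> \<infinity>"
  using assms by (auto simp: weighted_log_def)

lemma weighted_log_linear_le:
  fixes a c x :: real
  assumes "a \<ge> 0" "c > 0" "x \<ge> 0"
  shows "weighted_log a x + ereal (- c * x) \<le> weighted_log a (a / c) + ereal (- c * (a / c))"
  using weighted_log_linear_less[OF assms] by (cases "x = a / c") (auto simp: less_imp_le)

text \<open>Pricing the resource at \<open>v\<close> decouples the actions: each faces its own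
  log-linear problem with unit cost \<open>t + \<gamma> * v\<close>.\<close>

lemma lagrangian_split:
  "lagrangian m t1 t2 \<gamma>1 \<gamma>2 b y (x1, x2) v =
     (weighted_log y x1 + ereal (- (t1 + \<gamma>1 * v) * x1)) +
     (weighted_log (m - y) x2 + ereal (- (t2 + \<gamma>2 * v) * x2)) + ereal (v * b)"
proof -
  \<comment> \<open>Only the finite summands are regrouped, so the identity survives infinite
    \<open>W1\<close> or \<open>W2\<close>.\<close>
  have "W1 + W2 + ereal k + ereal l = (W1 + ereal p) + (W2 + ereal q) + ereal r"
    if "k + l = p + q + r" for W1 W2 :: ereal and k l p q r
    using that by (cases W1; cases W2) auto
  moreover have "- t1 * x1 - t2 * x2 + v * (b - (\<gamma>1 * x1 + \<gamma>2 * x2)) =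
      - (t1 + \<gamma>1 * v) * x1 + - (t2 + \<gamma>2 * v) * x2 + v * b"
    by (simp add: algebra_simps)
  ultimately show ?thesis
    unfolding lagrangian_def objective_def resource_slack_def split by blast
qed

text \<open>A saddle-point argument: the maximizer of the Lagrangian at price \<open>w\<close>
  exhausts the resource, so its Lagrangian value is the same at every price and bounds the dual
  function from below. A second dual minimizer \<open>v\<close> would make that same point maximal
  at price \<open>v\<close>, against strictness of the log-linear bound.\<close>

lemma multiplier_eqI:
  fixes m y t1 t2 \<gamma>1 \<gamma>2 b w :: real
  assumes pos: "m > 0" "t1 > 0" "t2 > 0" "\<gamma>1 > 0" "\<gamma>2 > 0"
    and y: "0 \<le> y" "y \<le> m" and w: "w \<ge> 0"
    and bal: "\<gamma>1 * (y / (t1 + \<gamma>1 * w)) + \<gamma>2 * ((m - y) / (t2 + \<gamma>2 * w)) = b"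
  shows "multiplier m t1 t2 \<gamma>1 \<gamma>2 b y = w"
proof -
  define L where "L = lagrangian m t1 t2 \<gamma>1 \<gamma>2 b y"
  define D where "D = dual_function m t1 t2 \<gamma>1 \<gamma>2 b y"
  \<comment> \<open>The maximizer of the Lagrangian at price \<open>v\<close>, one coordinate per
    decoupled problem.\<close>
  define z where "z v = (y / (t1 + \<gamma>1 * v), (m - y) / (t2 + \<gamma>2 * v))" for v
  have cpos: "t1 + \<gamma>1 * v > 0" "t2 + \<gamma>2 * v > 0" if "v \<ge> 0" for v
    using pos that by (auto intro: add_pos_nonneg)
  have z: "z v \<in> {0..} \<times> {0..}" if "v \<ge> 0" for v
    using cpos[OF that] y by (auto simp: z_def)
  have L_le_D: "L x v \<le> D v" if "x \<in> {0..} \<times> {0..}" for x v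
    unfolding L_def D_def dual_function_def using that by (rule SUP_upper)
  have L_le: "L x v \<le> L (z v) v" if "v \<ge> 0" and "x \<in> {0..} \<times> {0..}" for x v
    using cpos[OF that(1)] y that(2) unfolding L_def z_def
    by (cases x, simp only: lagrangian_split mem_Times_iff fst_conv snd_conv atLeast_iff)
      (intro add_right_mono add_mono weighted_log_linear_le, auto)
  have D_eq: "D v = L (z v) v" if "v \<ge> 0" for v
    using L_le[OF that] z[OF that] unfolding D_def dual_function_def L_def[symmetric]
    by (intro antisym SUP_least SUP_upper)
  \<comment> \<open>Complementary slackness: \<open>bal\<close> makes the slack at
    \<open>z w\<close> vanish, and with it the dependence on \<open>v\<close>.\<close>
  have L_zw: "L (z w) v = L (z w) w" for v
  proof -
    have "resource_slack \<gamma>1 \<gamma>2 b (z w) = 0"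
      using bal by (simp add: resource_slack_def z_def)
    then show ?thesis by (simp add: L_def lagrangian_def)
  qed
  have opt: "optimal_multiplier m t1 t2 \<gamma>1 \<gamma>2 b y w"
    unfolding optimal_multiplier_def D_def[symmetric]
  proof (intro conjI allI impI)
    fix v :: real assume "0 \<le> v"
    show "D w \<le> D v" using L_le_D[OF z[OF w], of v] by (simp add: D_eq[OF w] L_zw[of v])
  qed (fact w)
  have "v = w" if v: "optimal_multiplier m t1 t2 \<gamma>1 \<gamma>2 b y v" for v
  proof (rule ccontr)
    assume "v \<noteq> w"
    have v0: "0 \<le> v" and "D v \<le> D w"
      using v w by (auto simp: optimal_multiplier_def D_def)
    then have le: "L (z v) v \<le> L (z w) v" by (simp add: D_eq[OF v0] D_eq[OF w] L_zw[of v])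
    have ne: "a / (t + \<gamma> * w) \<noteq> a / (t + \<gamma> * v)"
      if "a > 0" "t > 0" "\<gamma> > 0" for a t \<gamma> :: real
    proof -
      have "t + \<gamma> * w > 0" "t + \<gamma> * v > 0" using that w v0 by (auto intro: add_pos_nonneg)
      then show ?thesis using that \<open>v \<noteq> w\<close> by (simp add: divide_cancel_left)
    qed
    define A where "A x = weighted_log y x + ereal (- (t1 + \<gamma>1 * v) * x)" for x
    define B where "B x = weighted_log (m - y) x + ereal (- (t2 + \<gamma>2 * v) * x)" for x
    have LAB: "L x v = A (fst x) + B (snd x) + ereal (v * b)" for x
      using lagrangian_split[of m t1 t2 \<gamma>1 \<gamma>2 b y "fst x" "snd x" v]
      by (simp only: L_def A_def B_def prod.collapse)
    have zw0: "fst (z w) \<ge> 0" "snd (z w) \<ge> 0" using z[OF w] by auto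
    have A_le: "A (fst (z w)) \<le> A (fst (z v))" and B_le: "B (snd (z w)) \<le> B (snd (z v))"
      using weighted_log_linear_le[of y "t1 + \<gamma>1 * v" "fst (z w)"]
        weighted_log_linear_le[of "m - y" "t2 + \<gamma>2 * v" "snd (z w)"] cpos[OF v0] y zw0
      by (auto simp: A_def B_def z_def)
    \<comment> \<open>As \<open>m > 0\<close>, at least one action carries positive mass, and its
      coordinate of the maximizer moves with the price.\<close>
    have strict: "A (fst (z w)) < A (fst (z v)) \<or> B (snd (z w)) < B (snd (z v))"
    proof (cases "y > 0")
      case True
      then have "fst (z w) \<noteq> fst (z v)" using ne pos by (simp add: z_def)
      then show ?thesis
        using weighted_log_linear_less[of y "t1 + \<gamma>1 * v" "fst (z w)"] cpos[OF v0] y zw0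
        by (auto simp: A_def z_def)
    next
      case False
      then have "snd (z w) \<noteq> snd (z v)" using ne[of "m - y"] pos by (simp add: z_def)
      then show ?thesis
        using weighted_log_linear_less[of "m - y" "t2 + \<gamma>2 * v" "snd (z w)"] cpos[OF v0] y zw0
        by (auto simp: B_def z_def)
    qed
    \<comment> \<open>Adding a strict and a weak inequality in \<open>ereal\<close> preserves
      strictness only when no infinite summand absorbs the difference.\<close>
    have "\<bar>A (fst (z v))\<bar> \<noteq> \<infinity>" "\<bar>B (snd (z v))\<bar> \<noteq> \<infinity>"
      using weighted_log_maximizer_finite[of y "t1 + \<gamma>1 * v"]
        weighted_log_maximizer_finite[of "m - y" "t2 + \<gamma>2 * v"] cpos[OF v0] y
      by (auto simp: A_def B_def z_def)
    then have "L (z w) v < L (z v) v"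
      using A_le B_le strict unfolding LAB
      by (cases "A (fst (z v))"; cases "B (snd (z v))"; cases "A (fst (z w))"; cases "B (snd (z w))") auto
    with le show False by simp
  qed
  with opt show ?thesis unfolding multiplier_def by (rule the_equality)
qed

text \<open>Swapping coordinates maps the quadrant onto itself and one Lagrangian to the other, so
  the dual functions coincide. This later transfers the first alternative to the second.\<close>

lemma multiplier_swap:
  "multiplier m t2 t1 \<gamma>2 \<gamma>1 b (m - y) = multiplier m t1 t2 \<gamma>1 \<gamma>2 b y"
proof -
  have L: "lagrangian m t2 t1 \<gamma>2 \<gamma>1 b (m - y) (prod.swap x) v = lagrangian m t1 t2 \<gamma>1 \<gamma>2 b y x v" for x v
    by (cases x) (simp only: prod.swap_def fst_conv snd_conv lagrangian_split, simp add: ac_simps)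
  have "dual_function m t2 t1 \<gamma>2 \<gamma>1 b (m - y) v = dual_function m t1 t2 \<gamma>1 \<gamma>2 b y v" for v
  proof -
    have "dual_function m t2 t1 \<gamma>2 \<gamma>1 b (m - y) v =
        (SUP x\<in>prod.swap ` ({0..} \<times> {0..}). lagrangian m t2 t1 \<gamma>2 \<gamma>1 b (m - y) x v)"
      by (simp add: dual_function_def product_swap)
    also have "\<dots> = dual_function m t1 t2 \<gamma>1 \<gamma>2 b y v"
      by (simp only: dual_function_def image_image L)
    finally show ?thesis .
  qed
  then show ?thesis by (simp add: multiplier_def optimal_multiplier_def)
qed

text \<open>
  Clearing denominators in the resource balance and solving for the mass using action 1 expresses
  that mass as an explicit quadratic polynomial in the multiplier.
\<close>
definition mass_of_multiplier :: "real \<Rightarrow> real \<Rightarrow> real \<Rightarrow> real \<Rightarrow> real \<Rightarrow> real \<Rightarrow> real \<Rightarrow> real" where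
  "mass_of_multiplier m t1 t2 \<gamma>1 \<gamma>2 b v =
     (t1 + \<gamma>1 * v) * (b * (t2 + \<gamma>2 * v) - \<gamma>2 * m) / (\<gamma>1 * t2 - \<gamma>2 * t1)"

text \<open>The cleared balance is linear in \<open>y\<close>. Its coefficient \<open>\<gamma>1 *
  (t2 + \<gamma>2 * v) - \<gamma>2 * (t1 + \<gamma>1 * v)\<close> loses its \<open>v\<close> terms,
  which leaves the constant denominator of \<open>mass_of_multiplier\<close>.\<close>

lemma balance_iff_mass:
  assumes "t1 + \<gamma>1 * v > 0" "t2 + \<gamma>2 * v > 0" "\<gamma>1 * t2 > \<gamma>2 * t1"
  shows "\<gamma>1 * (y / (t1 + \<gamma>1 * v)) + \<gamma>2 * ((m - y) / (t2 + \<gamma>2 * v)) = b \<longleftrightarrow>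
    mass_of_multiplier m t1 t2 \<gamma>1 \<gamma>2 b v = y"
proof -
  define c1 c2 where "c1 = t1 + \<gamma>1 * v" and "c2 = t2 + \<gamma>2 * v"
  have c: "c1 > 0" "c2 > 0" using assms by (auto simp: c1_def c2_def)
  have d: "\<gamma>1 * t2 - \<gamma>2 * t1 = \<gamma>1 * c2 - \<gamma>2 * c1" by (simp add: c1_def c2_def algebra_simps)
  have d0: "\<gamma>1 * c2 - \<gamma>2 * c1 > 0" using d assms by simp
  have "\<gamma>1 * (y / c1) + \<gamma>2 * ((m - y) / c2) = b \<longleftrightarrow> \<gamma>1 * y * c2 + \<gamma>2 * (m - y) * c1 = b * (c1 * c2)"
    using c by (simp add: add_frac_eq divide_eq_eq)
  also have "\<dots> \<longleftrightarrow> c1 * (b * c2 - \<gamma>2 * m) = y * (\<gamma>1 * c2 - \<gamma>2 * c1)"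
    by (auto simp: algebra_simps)
  also have "\<dots> \<longleftrightarrow> c1 * (b * c2 - \<gamma>2 * m) / (\<gamma>1 * c2 - \<gamma>2 * c1) = y"
    using d0 by (simp add: divide_eq_eq)
  finally show ?thesis by (simp add: mass_of_multiplier_def d c1_def c2_def)
qed

text \<open>The multiplier is a left inverse of the explicit polynomial \<open>h\<close>, so its
  properties are read off from \<open>h\<close>: continuity by inverting a continuous injection on a
  compact set, monotonicity from the signs of the two factors of \<open>h\<close>.\<close>

lemma multiplier_monotone_continuous:
  fixes m p t1 t2 \<gamma>1 \<gamma>2 b :: real
  assumes pos: "m > 0" "t1 > 0" "t2 > 0" "\<gamma>1 > 0" "\<gamma>2 > 0" "b > 0"
    and p: "0 \<le> p" "p \<le> m"
    and slope: "\<gamma>1 * t2 > \<gamma>2 * t1"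
    and scarce: "b < \<gamma>1 * (p / t1) + \<gamma>2 * ((m - p) / t2)"
  defines "w \<equiv> multiplier m t1 t2 \<gamma>1 \<gamma>2 b"
  shows "continuous_on {p..m} w"
    and "\<And>y. y \<in> {p..m} \<Longrightarrow> w y \<ge> 0"
    and "\<And>y. y \<in> {p<..m} \<Longrightarrow> w p < w y"
proof -
  define h where "h = mass_of_multiplier m t1 t2 \<gamma>1 \<gamma>2 b"
  have cpos: "t1 + \<gamma>1 * v > 0" "t2 + \<gamma>2 * v > 0" if "v \<ge> 0" for v
    using pos that by (auto intro: add_pos_nonneg)
  have w_h: "w (h v) = v" if "v \<ge> 0" "h v \<in> {0..m}" for v
    unfolding w_def
  proof (rule multiplier_eqI)
    show "\<gamma>1 * (h v / (t1 + \<gamma>1 * v)) + \<gamma>2 * ((m - h v) / (t2 + \<gamma>2 * v)) = b"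
      using cpos[OF that(1)] slope by (simp only: balance_iff_mass h_def)
  qed (use that pos in auto)
  \<comment> \<open>The bound \<open>m / b\<close> makes \<open>S\<close> compact. It suffices
    because each action's demand at price \<open>v\<close> is at most its mass divided by
    \<open>v\<close>, so total demand at \<open>m / b\<close> is at most \<open>b\<close>.\<close>
  define S where "S = {v \<in> {0..m / b}. h v \<in> {p..m}}"
  have cont_h: "continuous_on A h" for A
    unfolding h_def mass_of_multiplier_def using slope by (intro continuous_intros) auto
  have "compact S"
  proof -
    have "closed ({0..m / b} \<inter> h -` {p..m})"
      by (intro continuous_closed_preimage cont_h) auto
    moreover have "S = {0..m / b} \<inter> ({0..m / b} \<inter> h -` {p..m})" by (auto simp: S_def)
    ultimately show ?thesis by (metis compact_Icc compact_Int_closed)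
  qed
  have surj: "\<exists>v\<in>S. h v = y" if y: "y \<in> {p..m}" for y
  proof -
    define \<phi> where "\<phi> v = \<gamma>1 * (y / (t1 + \<gamma>1 * v)) + \<gamma>2 * ((m - y) / (t2 + \<gamma>2 * v))" for v
    \<comment> \<open>At price zero an agent on action 1 demands more than one on action 2, so
      scarcity at \<open>p\<close> persists for larger masses.\<close>
    have "\<gamma>1 * (p / t1) + \<gamma>2 * ((m - p) / t2) \<le> \<phi> 0"
    proof -
      have "(\<gamma>1 / t1 - \<gamma>2 / t2) * (y - p) \<ge> 0"
        using y slope pos by (intro mult_nonneg_nonneg) (auto simp: field_simps)
      then show ?thesis by (simp add: \<phi>_def algebra_simps diff_divide_distrib)
    qed
    then have lo: "b \<le> \<phi> 0" using scarce by simp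
    have mb: "m / b > 0" using pos by simp
    have "\<gamma> * (a / (t + \<gamma> * (m / b))) \<le> a * b / m" if "a \<ge> 0" "t > 0" "\<gamma> > 0" for a t \<gamma> :: real
    proof -
      have "\<gamma> * (a / (t + \<gamma> * (m / b))) \<le> \<gamma> * (a / (\<gamma> * (m / b)))"
        using that mb
        by (intro mult_left_mono divide_left_mono mult_pos_pos add_pos_pos) (auto intro: less_imp_le)
      also have "\<dots> = a * b / m" using that by simp
      finally show ?thesis .
    qed
    from this[of y t1 \<gamma>1] this[of "m - y" t2 \<gamma>2] have "\<phi> (m / b) \<le> y * b / m + (m - y) * b / m"
      using y p pos by (simp add: \<phi>_def add_mono)
    also have "\<dots> = b" using pos by (simp add: field_simps)
    finally have hi: "\<phi> (m / b) \<le> b" .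
    have "continuous_on {0..m / b} \<phi>"
      unfolding \<phi>_def using cpos by (intro continuous_intros) (auto simp: less_imp_neq[symmetric])
    then obtain v where "0 \<le> v" "v \<le> m / b" "\<phi> v = b"
      using IVT2'[of \<phi> "m / b" b 0] lo hi mb by auto
    moreover have "h v = y"
      using \<open>\<phi> v = b\<close> cpos[OF \<open>0 \<le> v\<close>] slope by (simp only: \<phi>_def balance_iff_mass h_def)
    ultimately show ?thesis using y by (intro bexI[of _ v]) (auto simp: S_def)
  qed
  have w_S: "w y \<in> S \<and> h (w y) = y" if "y \<in> {p..m}" for y
  proof -
    obtain v where "v \<in> S" "h v = y" using surj[OF \<open>y \<in> {p..m}\<close>] by auto
    then show ?thesis using w_h[of v] p by (auto simp: S_def)
  qed
  have "continuous_on (h ` S) w"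
    using \<open>compact S\<close> cont_h p by (intro continuous_on_inv) (auto simp: S_def w_h)
  then show "continuous_on {p..m} w"
    by (rule continuous_on_subset) (use surj in blast)
  show "w y \<ge> 0" if "y \<in> {p..m}" for y
    using w_S[OF that] by (simp add: S_def)
  show "w p < w y" if y: "y \<in> {p<..m}" for y
  proof (rule ccontr)
    assume "\<not> w p < w y"
    then have le: "w y \<le> w p" by simp
    have wy: "w y \<ge> 0" "h (w y) = y" and wp: "h (w p) = p"
      using w_S[of y] w_S[of p] y by (auto simp: S_def)
    have "(t1 + \<gamma>1 * w y) * (b * (t2 + \<gamma>2 * w y) - \<gamma>2 * m) = y * (\<gamma>1 * t2 - \<gamma>2 * t1)"
      using wy(2) slope by (simp add: h_def mass_of_multiplier_def divide_eq_eq)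
    \<comment> \<open>The sign of the product forces the second factor at \<open>w y\<close> to be
      nonnegative. Both factors are then nonnegative and nondecreasing in the multiplier, so their
      product is monotone from \<open>w y\<close> to \<open>w p\<close>.\<close>
    moreover have "0 \<le> y * (\<gamma>1 * t2 - \<gamma>2 * t1)"
      using y p slope by (intro mult_nonneg_nonneg) auto
    ultimately have "0 \<le> (t1 + \<gamma>1 * w y) * (b * (t2 + \<gamma>2 * w y) - \<gamma>2 * m)"
      by simp
    then have "0 \<le> b * (t2 + \<gamma>2 * w y) - \<gamma>2 * m"
      using cpos[OF wy(1)] by (simp add: zero_le_mult_iff)
    then have "(t1 + \<gamma>1 * w y) * (b * (t2 + \<gamma>2 * w y) - \<gamma>2 * m) \<le>
        (t1 + \<gamma>1 * w p) * (b * (t2 + \<gamma>2 * w p) - \<gamma>2 * m)"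
      using le pos wy(1) by (intro mult_mono) auto
    then have "h (w y) \<le> h (w p)"
      using slope by (simp add: h_def mass_of_multiplier_def divide_right_mono)
    with wy wp y show False by simp
  qed
qed

section \<open>Payoff advantage of action 1\<close>

lemma discounted_payoff_advantage:
  fixes t1 t2 r1 r2 \<gamma>1 \<gamma>2 \<beta> u v :: real
  assumes pos: "t1 > 0" "t2 > 0" "r1 > 0" "r2 > 0" "\<gamma>1 > 0" "\<gamma>2 > 0" "\<beta> > 0"
    and ratio: "\<gamma>1 / \<gamma>2 < (exp (\<beta> * t1) - 1) / exp (\<beta> * t1)"
    and uv: "0 \<le> u" "u < v"
    and eq: "r1 / (exp (\<beta> * (t1 + \<gamma>1 * u)) - 1) = r2 / (exp (\<beta> * (t2 + \<gamma>2 * u)) - 1)"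
  shows "r2 / (exp (\<beta> * (t2 + \<gamma>2 * v)) - 1) < r1 / (exp (\<beta> * (t1 + \<gamma>1 * v)) - 1)"
proof -
  define E1 E2 where "E1 x = exp (\<beta> * (t1 + \<gamma>1 * x))" and "E2 x = exp (\<beta> * (t2 + \<gamma>2 * x))" for x
  have E: "E1 x > 1" "E2 x > 1" "E1 x \<ge> exp (\<beta> * t1)" if "x \<ge> 0" for x
    using that pos by (auto simp: E1_def E2_def add_pos_nonneg intro!: mult_pos_pos)
  \<comment> \<open>Up to the constant \<open>ln (r1 / r2)\<close>, this is the logarithm of the
    payoff ratio of action 1 to action 2 at multiplier \<open>x\<close>.\<close>
  define H where "H x = ln (E2 x - 1) - ln (E1 x - 1)" for x
  have "H u < H v"
  proof (rule DERIV_pos_imp_increasing[OF uv(2)])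
    fix x assume "u \<le> x" "x \<le> v"
    then have x: "x \<ge> 0" using uv by simp
    let ?d = "\<beta> * \<gamma>2 * E2 x / (E2 x - 1) - \<beta> * \<gamma>1 * E1 x / (E1 x - 1)"
    have "(H has_real_derivative ?d) (at x)"
      using E(1,2)[OF x] unfolding H_def E1_def E2_def
      by (auto intro!: derivative_eq_intros simp: field_simps)
    moreover have "?d > 0"
    proof -
      \<comment> \<open>The two terms of the derivative are separated by
        \<open>\<beta> * \<gamma>2\<close>. The bound \<open>ratio\<close> gives
        \<open>\<gamma>1 < \<gamma>2 * (1 - 1 / E)\<close> at \<open>E = exp (\<beta> * t1)\<close>,
        and it only weakens as \<open>E\<close> grows to \<open>E1 x\<close>.\<close>
      have "\<gamma>1 < \<gamma>2 * (1 - 1 / exp (\<beta> * t1))"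
        using ratio pos by (simp add: field_simps)
      also have "\<dots> \<le> \<gamma>2 * (1 - 1 / E1 x)"
        using E[OF x] pos by (intro mult_left_mono diff_left_mono divide_left_mono) auto
      finally have "\<gamma>1 * E1 x < \<gamma>2 * (E1 x - 1)"
        using E(1)[OF x] by (simp add: field_simps)
      then have "\<gamma>1 * E1 x / (E1 x - 1) < \<gamma>2"
        using E(1)[OF x] by (simp add: pos_divide_less_eq)
      also have "\<gamma>2 < \<gamma>2 * E2 x / (E2 x - 1)"
        using E(2)[OF x] pos by (simp add: pos_less_divide_eq algebra_simps)
      finally have "\<beta> * (\<gamma>1 * E1 x / (E1 x - 1)) < \<beta> * (\<gamma>2 * E2 x / (E2 x - 1))"
        using pos by (intro mult_strict_left_mono)
      then show ?thesis by (simp add: mult.assoc)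
    qed
    ultimately show "\<exists>d. (H has_real_derivative d) (at x) \<and> 0 < d" by blast
  qed
  moreover have "H x = ln ((E2 x - 1) / (E1 x - 1))" if "x \<ge> 0" for x
    using E(1,2)[OF that] by (simp add: H_def ln_div)
  ultimately have "(E2 u - 1) / (E1 u - 1) < (E2 v - 1) / (E1 v - 1)"
    using E(1,2)[of u] E(1,2)[of v] uv by simp
  \<comment> \<open>Equal payoffs at \<open>u\<close> identify the starting value of the increasing
    ratio as the break-even value \<open>r2 / r1\<close>.\<close>
  moreover have "(E2 u - 1) / (E1 u - 1) = r2 / r1"
    using eq[folded E1_def E2_def] E(1,2)[of u] uv pos by (simp add: field_simps)
  ultimately show ?thesis
    unfolding E1_def[symmetric] E2_def[symmetric]
    using E(1,2)[of v] uv pos by (simp add: field_simps)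
qed

lemma payoff_difference_positive:
  fixes m p t1 t2 r1 r2 \<gamma>1 \<gamma>2 b \<beta> :: real
  assumes pos: "m > 0" "t1 > 0" "t2 > 0" "r1 > 0" "r2 > 0" "\<gamma>1 > 0" "\<gamma>2 > 0" "b > 0" "\<beta> > 0"
    and p: "0 \<le> p" "p \<le> m"
    and slope: "\<gamma>1 / \<gamma>2 > t1 / t2"
    and ratio: "\<gamma>1 / \<gamma>2 < (exp (\<beta> * t1) - 1) / exp (\<beta> * t1)"
    and scarce: "b < \<gamma>1 * (p / t1) + \<gamma>2 * ((m - p) / t2)"
  defines "F1 \<equiv> discounted_payoff \<beta> r1 (sojourn1 m t1 t2 \<gamma>1 \<gamma>2 b)"
    and "F2 \<equiv> discounted_payoff \<beta> r2 (sojourn2 m t1 t2 \<gamma>1 \<gamma>2 b)"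
  assumes eq: "F1 p = F2 p"
  shows "continuous_on {p..m} (\<lambda>y. F1 y - F2 y)"
    and "\<And>y. y \<in> {p<..m} \<Longrightarrow> F2 y < F1 y"
proof -
  have slope': "\<gamma>1 * t2 > \<gamma>2 * t1" using slope pos by (simp add: field_simps)
  note w = multiplier_monotone_continuous[OF pos(1-3,6-8) p slope' scarce]
  have ne: "exp (\<beta> * (t + \<gamma> * multiplier m t1 t2 \<gamma>1 \<gamma>2 b y)) - 1 \<noteq> 0"
    if "y \<in> {p..m}" "t > 0" "\<gamma> > 0" for y t \<gamma>
  proof -
    have "t + \<gamma> * multiplier m t1 t2 \<gamma>1 \<gamma>2 b y > 0"
      using w(2)[OF that(1)] that by (intro add_pos_nonneg) auto
    then show ?thesis using pos by simp
  qed
  show "continuous_on {p..m} (\<lambda>y. F1 y - F2 y)"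
    unfolding F1_def F2_def discounted_payoff_def sojourn1_def sojourn2_def
    by (intro continuous_intros w(1) ballI ne) (use pos in auto)
  show "F2 y < F1 y" if "y \<in> {p<..m}" for y
    using discounted_payoff_advantage[OF pos(2-7,9) ratio w(2)[of p] w(3)[OF that]] eq p
    by (simp add: F1_def F2_def discounted_payoff_def sojourn1_def sojourn2_def)
qed

section \<open>Escaping trajectories\<close>

text \<open>
  Separation of variables: the trajectory inverts the travel time \<open>y \<mapsto> \<integral>\<^sub>a\<^sup>y 1 / V\<close>, which is finite
  at \<open>c\<close>, and rests at \<open>c\<close> from then on.
\<close>
lemma caratheodory_solution_reaching:
  fixes a c :: real and V K :: "real \<Rightarrow> real"
  assumes ac: "a < c" and K: "continuous_on {a..c} K" "\<And>y. y \<in> {a..c} \<Longrightarrow> K y > 0"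
    and V: "\<And>y. y \<in> {a..<c} \<Longrightarrow> V y = K y" "V c = 0"
    and X: "{a..c} \<subseteq> X"
  obtains x T where "caratheodory_solution X V x" "x 0 = a" "T \<ge> 0" "x T = c"
proof -
  \<comment> \<open>The integrand uses \<open>K\<close> and not \<open>V\<close>: \<open>V\<close>
    vanishes at \<open>c\<close>, while \<open>K\<close> stays positive and continuous there, which
    keeps the travel time finite.\<close>
  define f where "f y = 1 / K y" for y
  define \<theta> where "\<theta> y = integral {a..y} f" for y
  have cont_f: "continuous_on {a..c} f"
    unfolding f_def using K by (intro continuous_intros) (auto simp: less_imp_neq[symmetric])
  have cont_\<theta>: "continuous_on {a..c} \<theta>"
    unfolding \<theta>_def by (rule indefinite_integral_continuous_1) (rule integrable_continuous_interval[OF cont_f])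
  have d\<theta>: "(\<theta> has_real_derivative f y) (at y)" if "y \<in> {a<..<c}" for y
  proof -
    have "(\<theta> has_vector_derivative f y) (at y within {a..c})"
      unfolding \<theta>_def using that cont_f by (intro integral_has_vector_derivative) auto
    then have "(\<theta> has_vector_derivative f y) (at y)"
      using that by (simp add: at_within_Icc_at)
    then show ?thesis by (simp add: has_real_derivative_iff_has_vector_derivative)
  qed
  have mono: "\<theta> y < \<theta> z" if "a \<le> y" "y < z" "z \<le> c" for y z
  proof (rule DERIV_pos_imp_increasing_open[OF that(2)])
    show "\<exists>d. (\<theta> has_real_derivative d) (at u) \<and> 0 < d" if "y < u" "u < z" for u
      using d\<theta>[of u] K(2)[of u] that \<open>a \<le> y\<close> \<open>z \<le> c\<close> by (auto simp: f_def)
    show "continuous_on {y..z} \<theta>" by (rule continuous_on_subset[OF cont_\<theta>]) (use that in auto)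
  qed
  have \<theta>a: "\<theta> a = 0" by (simp add: \<theta>_def)
  define T where "T = \<theta> c"
  have T: "T > 0" using mono[of a c] ac \<theta>a by (simp add: T_def)
  have inj: "inj_on \<theta> {a..c}"
    by (rule inj_onI) (metis atLeastAtMost_iff linorder_neqE_linordered_idom mono order_less_irrefl)
  define g where "g = inv_into {a..c} \<theta>"
  have g\<theta>: "g (\<theta> y) = y" if "y \<in> {a..c}" for y
    unfolding g_def using inj that by (rule inv_into_f_f)
  have ex: "\<exists>y\<in>{a..c}. \<theta> y = s" if "s \<in> {0..T}" for s
    using IVT'[of \<theta> a s c] cont_\<theta> that ac by (auto simp: \<theta>a T_def)
  then have g: "g s \<in> {a..c}" "\<theta> (g s) = s" if "s \<in> {0..T}" for s
    using that by (metis g\<theta>)+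
  have cont_g: "continuous_on {0..T} g"
    by (rule continuous_on_subset[of "\<theta> ` {a..c}"], rule continuous_on_inv)
      (use cont_\<theta> g\<theta> ex in force)+
  have g0: "g 0 = a" and gT: "g T = c" using g\<theta>[of a] g\<theta>[of c] ac by (auto simp: \<theta>a T_def)
  have g_less: "g s < c" if "0 \<le> s" "s < T" for s
    using g[of s] that by (metis T_def atLeastAtMost_iff less_eq_real_def less_irrefl)
  have g_gr: "a < g s" if "0 < s" "s \<le> T" for s
    using g[of s] that by (metis \<theta>a atLeastAtMost_iff less_eq_real_def less_irrefl)
  have dg: "(g has_real_derivative K (g s)) (at s)" if "0 < s" "s < T" for s
  proof -
    have gs: "g s \<in> {a<..<c}" using g_less g_gr that by simp
    have "isCont g s"
      using continuous_on_interior[OF cont_g] that by simp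
    then have "(g has_real_derivative inverse (f (g s))) (at s)"
      using d\<theta>[OF gs] K(2)[of "g s"] gs that g
      by (intro DERIV_inverse_function[where f = \<theta> and a = 0 and b = T]) (auto simp: f_def)
    then show ?thesis by (simp add: f_def)
  qed
  \<comment> \<open>Resting at \<open>c\<close> after time \<open>T\<close> is consistent with the
    equation because \<open>V c = 0\<close>.\<close>
  define x where "x s = (if s \<le> T then g s else c)" for s
  have x_in: "x s \<in> {a..c}" if "s \<ge> 0" for s
    using g[of s] that ac by (auto simp: x_def)
  have int1: "((\<lambda>u. V (x u)) has_integral x s - x 0) {0..s}" if "0 \<le> s" "s \<le> T" for s
  proof -
    have Kg: "((\<lambda>u. K (g u)) has_integral g s - g 0) {0..s}"
      using that
      by (intro fundamental_theorem_of_calculus_interior continuous_on_subset[OF cont_g])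
        (auto simp: dg has_real_derivative_iff_has_vector_derivative[symmetric])
    \<comment> \<open>At \<open>u = T\<close> the field jumps from \<open>K c > 0\<close> to
      \<open>0\<close>; a single point does not affect the integral.\<close>
    have "V (x u) = K (g u)" if u: "u \<in> {0..s} - {T}" for u
    proof -
      have "0 \<le> u" "u < T" using u \<open>s \<le> T\<close> by auto
      then show ?thesis using V(1)[of "g u"] g_less[of u] g[of u] by (simp add: x_def)
    qed
    then have "((\<lambda>u. V (x u)) has_integral g s - g 0) {0..s}"
      by (rule has_integral_spike_finite[OF _ _ Kg, of "{T}", rotated]) simp_all
    then show ?thesis using that T by (simp add: x_def)
  qed
  have xT: "x u = c" if "u \<ge> T" for u
    using that gT by (simp add: x_def)
  have int2: "((\<lambda>u. V (x u)) has_integral x s - x 0) {0..s}" if "s \<ge> T" for s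
  proof -
    have "((\<lambda>u. V (x u)) has_integral 0) {T..s}"
      by (rule has_integral_is_0) (simp add: xT V(2))
    with int1[of T] have "((\<lambda>u. V (x u)) has_integral (x T - x 0) + 0) {0..s}"
      using that T by (intro has_integral_combine[of 0 T s]) auto
    then show ?thesis using that by (simp add: xT)
  qed
  have int: "((\<lambda>u. V (x u)) has_integral x s - x 0) {0..s}" if "s \<ge> 0" for s
    using int1[of s] int2[of s] that by linarith
  \<comment> \<open>A nonnegative integrable function is absolutely integrable, as the solution
    concept demands.\<close>
  have nonneg: "V (x u) \<ge> 0" if "u \<ge> 0" for u
    using x_in[OF that] V K(2)[of "x u"] by (cases "x u = c") (auto simp: less_imp_le)
  have "caratheodory_solution X V x"
    unfolding caratheodory_solution_def
  proof (intro conjI allI impI)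
    fix s :: real assume s: "0 \<le> s"
    show "x s \<in> X" using x_in[OF s] X by auto
    show "(\<lambda>u. V (x u)) absolutely_integrable_on {0..s}"
      using int[OF s] nonneg by (intro nonnegative_absolutely_integrable_1) auto
    show "x s = x 0 + integral {0..s} (\<lambda>u. V (x u))"
      using integral_unique[OF int[OF s]] by simp
  qed
  moreover have "x 0 = a" using g0 T by (simp add: x_def)
  ultimately show ?thesis using that[of x T] T xT[of T] by simp
qed

text \<open>Positivity of \<open>K\<close> is asked only to the right of \<open>p\<close>, since
  \<open>p\<close> may be a rest point. Trajectories start slightly beyond \<open>p\<close>, where
  separation of variables applies.\<close>

lemma not_lyapunov_stable_if_escaping:
  fixes p c :: real
  assumes pc: "p < c" "{p..c} \<subseteq> X"
    and K: "continuous_on {p..c} K" "\<And>y. y \<in> {p<..c} \<Longrightarrow> K y > 0"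
    and V: "\<And>y. y \<in> {p<..<c} \<Longrightarrow> V y = K y" "V c = 0"
  shows "\<not> lyapunov_stable X V p"
proof
  assume "lyapunov_stable X V p"
  then obtain \<delta> where \<delta>: "\<delta> > 0" and stable:
    "\<And>x s. caratheodory_solution X V x \<Longrightarrow> dist (x 0) p < \<delta> \<Longrightarrow> s \<ge> 0 \<Longrightarrow> dist (x s) p < c - p"
    using pc unfolding lyapunov_stable_def by (metis diff_gt_0_iff_gt)
  \<comment> \<open>The start lies within \<open>\<delta>\<close> of \<open>p\<close> and strictly
    before \<open>c\<close>. Arrival at \<open>c\<close> then violates the radius
    \<open>c - p\<close> chosen for stability.\<close>
  define a where "a = p + min (\<delta> / 2) ((c - p) / 2)"
  have a: "p < a" "a < c" "a - p < \<delta>" using \<delta> pc by (auto simp: a_def min_def field_simps)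
  obtain x T where "caratheodory_solution X V x" "x 0 = a" "T \<ge> 0" "x T = c"
    by (rule caratheodory_solution_reaching[of a c K V X])
      (use a pc K V in \<open>auto intro: continuous_on_subset\<close>)
  then show False using stable[of x T] a by (simp add: dist_real_def)
qed

section \<open>Reflection of the mass interval\<close>

lemma caratheodory_solution_reflect:
  fixes m :: real
  assumes "caratheodory_solution {0..m} (\<lambda>y. - V (m - y)) x"
  shows "caratheodory_solution {0..m} V (\<lambda>s. m - x s)"
proof -
  have "(\<lambda>u. V (m - x u)) absolutely_integrable_on {0..s}"
    if "(\<lambda>u. - V (m - x u)) absolutely_integrable_on {0..s}" for s
    using absolutely_integrable_scaleR_left[OF that, of "-1"] by simp
  moreover have "m - x s \<in> {0..m} \<longleftrightarrow> x s \<in> {0..m}" for s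
    by auto
  moreover have "m - x s = m - x 0 + integral {0..s} (\<lambda>u. V (m - x u))"
    if "x s = x 0 + integral {0..s} (\<lambda>u. - V (m - x u))" for s
    using that by simp
  ultimately show ?thesis
    using assms unfolding caratheodory_solution_def by blast
qed

text \<open>The map \<open>y \<mapsto> m - y\<close> is an isometry of the interval carrying
  trajectories to trajectories, so the same \<open>\<delta>\<close> serves both systems.\<close>

lemma lyapunov_stable_reflect:
  fixes m :: real
  assumes "lyapunov_stable {0..m} V p"
  shows "lyapunov_stable {0..m} (\<lambda>y. - V (m - y)) (m - p)"
  unfolding lyapunov_stable_def
proof (intro allI impI)
  fix \<epsilon> :: real assume "\<epsilon> > 0"
  then obtain \<delta> where "\<delta> > 0" and \<delta>:
    "\<And>x s. caratheodory_solution {0..m} V x \<Longrightarrow> dist (x 0) p < \<delta> \<Longrightarrow> s \<ge> 0 \<Longrightarrow> dist (x s) p < \<epsilon>"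
    using assms unfolding lyapunov_stable_def by metis
  have "dist (x s) (m - p) < \<epsilon>"
    if "caratheodory_solution {0..m} (\<lambda>y. - V (m - y)) x" "dist (x 0) (m - p) < \<delta>" "s \<ge> 0" for x s
    using \<delta>[OF caratheodory_solution_reflect[OF that(1)], of s] that(2,3)
    by (simp add: dist_real_def abs_minus_commute algebra_simps)
  with \<open>\<delta> > 0\<close> show "\<exists>\<delta>>0. \<forall>x. caratheodory_solution {0..m} (\<lambda>y. - V (m - y)) x \<and>
      dist (x 0) (m - p) < \<delta> \<longrightarrow> (\<forall>s\<ge>0. dist (x s) (m - p) < \<epsilon>)"
    by blast
qed

section \<open>The two alternatives of the parameter condition\<close>

theorem proposition7:
  fixes m \<mu> t1 t2 r1 r2 \<gamma>1 \<gamma>2 b \<beta> :: real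
  defines "\<tau>1 \<equiv> sojourn1 m t1 t2 \<gamma>1 \<gamma>2 b"
    and "\<tau>2 \<equiv> sojourn2 m t1 t2 \<gamma>1 \<gamma>2 b"
  assumes "m > 0" and "\<mu> \<in> {0<..<m}"
    and "t1 > 0" and "t2 > 0" and "r1 > 0" and "r2 > 0"
    and "\<gamma>1 > 0" and "\<gamma>2 > 0" and "b > 0" and "\<beta> > 0"
    and "(\<gamma>1 / \<gamma>2 > t1 / t2 \<and> \<gamma>1 / \<gamma>2 < (exp (\<beta> * t1) - 1) / exp (\<beta> * t1)) \<or>
         (\<gamma>1 / \<gamma>2 < t1 / t2 \<and> \<gamma>1 / \<gamma>2 > exp (\<beta> * t2) / (exp (\<beta> * t2) - 1))"
    and "r1 / (exp (\<beta> * \<tau>1 \<mu>) - 1) = r2 / (exp (\<beta> * \<tau>2 \<mu>) - 1)"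
    and "b < \<gamma>1 * (\<mu> / t1) + \<gamma>2 * ((m - \<mu>) / t2)"
  shows "unstable_equilibrium m (discounted_payoff \<beta> r1 \<tau>1) (discounted_payoff \<beta> r2 \<tau>2) \<mu>"
proof -
  define F1 where "F1 = discounted_payoff \<beta> r1 \<tau>1"
  define F2 where "F2 = discounted_payoff \<beta> r2 \<tau>2"
  define V where "V = projection_field m F1 F2"
  note pos = assms(3,5-12)
  have \<mu>: "0 < \<mu>" "\<mu> < m" using assms(4) by auto
  have eq: "F1 \<mu> = F2 \<mu>"
    using assms(14) by (simp add: F1_def F2_def discounted_payoff_def)
  then have equil: "equilibrium m F1 F2 \<mu>"
    using \<mu> by (simp add: equilibrium_def)
  from assms(13) have "\<not> lyapunov_stable {0..m} V \<mu>"
  proof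
    assume c: "\<gamma>1 / \<gamma>2 > t1 / t2 \<and> \<gamma>1 / \<gamma>2 < (exp (\<beta> * t1) - 1) / exp (\<beta> * t1)"
    note adv = payoff_difference_positive[of m t1 t2 r1 r2 \<gamma>1 \<gamma>2 b \<beta> \<mu>,
        folded \<tau>1_def \<tau>2_def, folded F1_def F2_def]
    show ?thesis
    proof (rule not_lyapunov_stable_if_escaping[where K = "\<lambda>y. F1 y - F2 y"])
      show "continuous_on {\<mu>..m} (\<lambda>y. F1 y - F2 y)"
        using adv(1) pos \<mu> c eq assms(15) by simp
      have gt: "F2 y < F1 y" if "y \<in> {\<mu><..m}" for y
        using adv(2)[OF _ _ _ _ _ _ _ _ _ _ _ _ _ _ _ that] pos \<mu> c eq assms(15) by simp
      then show "F1 y - F2 y > 0" if "y \<in> {\<mu><..m}" for y using that by simp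
      show "V y = F1 y - F2 y" if "y \<in> {\<mu><..<m}" for y
        using that \<mu> by (simp add: V_def projection_field_def)
      \<comment> \<open>Action 1 is strictly better at \<open>m\<close>, so the projection clips the
        positive difference to zero.\<close>
      show "V m = 0" using gt[of m] \<mu> by (simp add: V_def projection_field_def)
    qed (use \<mu> in auto)
  next
    assume c: "\<gamma>1 / \<gamma>2 < t1 / t2 \<and> \<gamma>1 / \<gamma>2 > exp (\<beta> * t2) / (exp (\<beta> * t2) - 1)"
    \<comment> \<open>The game with the actions exchanged: action 2 plays the first role, and the
      state is the mass on action 2.\<close>
    define G1 where "G1 = discounted_payoff \<beta> r2 (sojourn1 m t2 t1 \<gamma>2 \<gamma>1 b)"
    define G2 where "G2 = discounted_payoff \<beta> r1 (sojourn2 m t2 t1 \<gamma>2 \<gamma>1 b)"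
    have G: "G1 y = F2 (m - y)" "G2 y = F1 (m - y)" for y
      using multiplier_swap[of m t2 t1 \<gamma>2 \<gamma>1 b "m - y"]
      by (simp_all add: G1_def G2_def F1_def F2_def \<tau>1_def \<tau>2_def discounted_payoff_def
          sojourn1_def sojourn2_def)
    note adv = payoff_difference_positive[of m t2 t1 r2 r1 \<gamma>2 \<gamma>1 b \<beta> "m - \<mu>",
        folded G1_def G2_def]
    have c1: "t2 / t1 < \<gamma>2 / \<gamma>1" using c pos by (simp add: field_simps)
    have "exp (\<beta> * t2) > 1" using pos by simp
    \<comment> \<open>Taking reciprocals turns the second alternative into the first for the
      exchanged game; \<open>exp (\<beta> * t2) > 1\<close> keeps the denominators positive.\<close>
    then have c2: "\<gamma>2 / \<gamma>1 < (exp (\<beta> * t2) - 1) / exp (\<beta> * t2)"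
      using c pos by (simp add: field_simps)
    have eq': "G1 (m - \<mu>) = G2 (m - \<mu>)" using eq by (simp add: G)
    have scarce: "b < \<gamma>2 * ((m - \<mu>) / t2) + \<gamma>1 * ((m - (m - \<mu>)) / t1)"
      using assms(15) by simp
    have "\<not> lyapunov_stable {0..m} (\<lambda>y. - V (m - y)) (m - \<mu>)"
    proof (rule not_lyapunov_stable_if_escaping[where K = "\<lambda>y. G1 y - G2 y" and c = m])
      show "continuous_on {m - \<mu>..m} (\<lambda>y. G1 y - G2 y)"
        using adv(1) pos \<mu> c1 c2 eq' scarce by simp
      have gt: "G2 y < G1 y" if "y \<in> {m - \<mu><..m}" for y
        using adv(2)[OF _ _ _ _ _ _ _ _ _ _ _ _ _ _ _ that] pos \<mu> c1 c2 eq' scarce by simp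
      then show "G1 y - G2 y > 0" if "y \<in> {m - \<mu><..m}" for y using that by simp
      show "- V (m - y) = G1 y - G2 y" if "y \<in> {m - \<mu><..<m}" for y
        using that \<mu> by (simp add: V_def projection_field_def G)
      \<comment> \<open>The reflected end point is the state \<open>0\<close>, where action 2 is
        strictly better and the projection clips the negative difference to zero.\<close>
      show "- V (m - m) = 0" using gt[of m] \<mu> by (simp add: V_def projection_field_def G)
    qed (use \<mu> in auto)
    then show ?thesis using lyapunov_stable_reflect by blast
  qed
  with equil show ?thesis
    by (simp add: unstable_equilibrium_def V_def F1_def F2_def)
qed

end
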